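(* Let $D$ be a diagram in $[n]\times[n]$ such that there do not exist $1\le i_1<i_2\le n$ and $1\le j_1<j_2\le n$ with $(i_1,j_1),(i_1,j_2)\notin D$ and $(i_2,j_1),(i_2,j_2)\in D$. Let $x^a$ be any monomial appearing in $\chi_D(x)$. Then the family of polynomials $\big(\det(Y_D^C)\big)_{C}$, indexed by the diagrams $C\le D$ with $x^C=x^a$, is linearly independent over $\mathbb{C}$.
   Context: Write $[n]=\{1,\dots,n\}$. A diagram is a subset $D\subseteq[n]\times[n]$; $(i,j)$ is the box in row $i$, column $j$. We identify $D$ with $(D_1,\dots,D_n)$, $i\in D_j$ iff $(i,j)\in D$. For $R=\{r_1<\dots<r_m\}$, $S=\{s_1<\dots<s_m\}\subseteq[n]$, $R\le S$ means $r_k\le s_k$ for all $k$; for diagrams, $C\le D$ means $|C_j|=|D_j|$ and $C_j\le D_j$ for all $j$. For a diagram $C$, $x^C=\prod_j\prod_{i\in C_j}x_i$. $Y$ is the upper-triangular $n\times n$ matrix with entries indeterminates $y_{ij}$ ($i\le j$) and $0$ below the diagonal; $\mathbb{C}[Y]$ is the polynomial ring in these variables; $Y^R_S$ is the submatrix of $Y$ with rows $R$ and columns $S$; $\det(Y_D^C)=\prod_j\det(Y^{C_j}_{D_j})$. The group $B$ of invertible upper-triangular complex matrices acts on $\mathbb{C}[Y]$ by $(f\cdot b)(Y)=f(b^{-1}Y)$. The flagged Weyl module is $\mathcal{M}_D=\mathrm{Span}_{\mathbb{C}}\{\det(Y_D^C):C\le D\}$, a $B$-module; its character is the trace of the diagonal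 matrix $X=\mathrm{diag}(x_1,\dots,x_n)$ acting on $\mathcal{M}_D$, and the dual character is $\chi_D(x)=\mathrm{char}(\mathcal{M}_D)(x_1^{-1},\dots,x_n^{-1})$. The monomials appearing in $\chi_D(x)$ are exactly the $x^C$ with $C\le D$. *)

theory Defs
  imports
    Complex_Main
    "HOL-Library.Poly_Mapping"
    "Jordan_Normal_Form.Determinant"
    "Jordan_Normal_Form.Gauss_Jordan_Elimination"
    "Jordan_Normal_Form.DL_Submatrix"
begin

text \<open>
  Indices are 0-based, as for the matrices of \<^theory>\<open>Jordan_Normal_Form.Matrix\<close>: the index set
  $[n] = \{1, \dots, n\}$ is \<open>{..<n}\<close>, and the box in row \<open>i\<close> and column \<open>j\<close> is \<open>(i, j)\<close> with
  \<open>i, j < n\<close>.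
\<close>

section \<open>Complex polynomials in several variables\<close>

type_synonym 'v mpoly = "('v \<Rightarrow>\<^sub>0 nat) \<Rightarrow>\<^sub>0 complex"

definition mconst :: "complex \<Rightarrow> 'v mpoly" where
  "mconst c = Poly_Mapping.single 0 c"

definition mvar :: "'v \<Rightarrow> 'v mpoly" where
  "mvar v = Poly_Mapping.single (Poly_Mapping.single v 1) 1"

definition mmonom :: "('v \<Rightarrow>\<^sub>0 nat) \<Rightarrow> 'v mpoly" where
  "mmonom a = Poly_Mapping.single a 1"

definition mscale :: "complex \<Rightarrow> 'v mpoly \<Rightarrow> 'v mpoly" where
  "mscale c p = Poly_Mapping.map ((*) c) p"

lemma lookup_mscale: "Poly_Mapping.lookup (mscale c p) m = c * Poly_Mapping.lookup p m"
  by (simp add: mscale_def Poly_Mapping.map.rep_eq when_def)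

global_interpretation mpoly: Vector_Spaces.vector_space mscale
  by unfold_locales
    (auto intro!: poly_mapping_eqI simp: lookup_mscale lookup_add algebra_simps)

definition mpoly_vars :: "'v mpoly \<Rightarrow> 'v set" where
  "mpoly_vars p = (\<Union>m\<in>Poly_Mapping.keys p. Poly_Mapping.keys m)"

text \<open>
  The value of a polynomial at \<open>\<sigma>\<close> in a commutative \<open>\<complex>\<close>-algebra with structure map \<open>h\<close>.
\<close>

definition mpoly_eval :: "(complex \<Rightarrow> 'r::comm_ring_1) \<Rightarrow> ('v \<Rightarrow> 'r) \<Rightarrow> 'v mpoly \<Rightarrow> 'r" where
  "mpoly_eval h \<sigma> p =
     (\<Sum>m\<in>Poly_Mapping.keys p.
        h (Poly_Mapping.lookup p m) * (\<Prod>v\<in>Poly_Mapping.keys m. \<sigma> v ^ Poly_Mapping.lookup m v))"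

section \<open>Diagrams\<close>

definition column :: "(nat \<times> nat) set \<Rightarrow> nat \<Rightarrow> nat set" where
  "column D j = {i. (i, j) \<in> D}"

text \<open>\<open>pick S k\<close> is the \<open>k\<close>-th smallest element of \<open>S\<close>, counting from 0.\<close>

definition subset_le :: "nat set \<Rightarrow> nat set \<Rightarrow> bool" where
  "subset_le R S \<longleftrightarrow> card R = card S \<and> (\<forall>k<card R. pick R k \<le> pick S k)"

definition diagrams_below :: "nat \<Rightarrow> (nat \<times> nat) set \<Rightarrow> (nat \<times> nat) set set" where
  "diagrams_below n D =
     {C. C \<subseteq> {..<n} \<times> {..<n} \<and> (\<forall>j<n. subset_le (column C j) (column D j))}"

definition diagram_monom :: "nat \<Rightarrow> (nat \<times> nat) set \<Rightarrow> nat mpoly" where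
  "diagram_monom n C = (\<Prod>j<n. \<Prod>i\<in>column C j. mvar i)"

section \<open>Flagged Weyl modules\<close>

text \<open>
  \<open>\<complex>[Y]\<close> is the subring of \<^typ>\<open>(nat \<times> nat) mpoly\<close> generated by the variables \<open>mvar (i, j)\<close> with
  \<open>i \<le> j < n\<close>; all polynomials built below lie in it.
\<close>

definition Ymat :: "nat \<Rightarrow> (nat \<times> nat) mpoly mat" where
  "Ymat n = mat n n (\<lambda>(i, j). if i \<le> j then mvar (i, j) else 0)"

definition diagram_det :: "nat \<Rightarrow> (nat \<times> nat) set \<Rightarrow> (nat \<times> nat) set \<Rightarrow> (nat \<times> nat) mpoly" where
  "diagram_det n C D = (\<Prod>j<n. det (submatrix (Ymat n) (column C j) (column D j)))"

definition weyl_module :: "nat \<Rightarrow> (nat \<times> nat) set \<Rightarrow> (nat \<times> nat) mpoly set" where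
  "weyl_module n D = mpoly.span ((\<lambda>C. diagram_det n C D) ` diagrams_below n D)"

text \<open>
  \<open>(f \<cdot> b)(Y) = f(b\<inverse> Y)\<close>, for \<open>b\<close> an invertible upper triangular \<open>n \<times> n\<close> matrix: every variable
  \<open>y\<^sub>i\<^sub>j\<close> is replaced by the \<open>(i, j)\<close> entry of \<open>b\<inverse> Y\<close>.
\<close>

definition borel_act :: "nat \<Rightarrow> complex mat \<Rightarrow> (nat \<times> nat) mpoly \<Rightarrow> (nat \<times> nat) mpoly" where
  "borel_act n b f =
     mpoly_eval mconst (\<lambda>(i, j). (map_mat mconst (the (mat_inverse b)) * Ymat n) $$ (i, j)) f"

text \<open>
  The trace of a linear operator \<open>T\<close> on a finite-dimensional \<open>T\<close>-invariant subspace \<open>V\<close>, computed in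
  some basis of \<open>V\<close>.
\<close>

definition trace_on :: "'v mpoly set \<Rightarrow> ('v mpoly \<Rightarrow> 'v mpoly) \<Rightarrow> complex" where
  "trace_on V T =
     (let B = (SOME B. mpoly.independent B \<and> mpoly.span B = V)
      in \<Sum>e\<in>B. mpoly.representation B (T e) e)"

definition weyl_char :: "nat \<Rightarrow> (nat \<times> nat) set \<Rightarrow> (nat \<Rightarrow> complex) \<Rightarrow> complex" where
  "weyl_char n D x = trace_on (weyl_module n D) (borel_act n (mat_diag n x))"

definition dual_char :: "nat \<Rightarrow> (nat \<times> nat) set \<Rightarrow> (nat \<Rightarrow> complex) \<Rightarrow> complex" where
  "dual_char n D x = weyl_char n D (\<lambda>i. inverse (x i))"

text \<open>
  \<open>dual_char n D\<close> is a function on the torus \<open>(\<complex> - {0})\<^sup>n\<close>; it is given there by a unique polynomial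
  in \<open>x\<^sub>0, \<dots>, x\<^sub>n\<^sub>-\<^sub>1\<close>, and the monomials appearing in the dual character are the monomials of that
  polynomial.
\<close>

definition dual_char_poly :: "nat \<Rightarrow> (nat \<times> nat) set \<Rightarrow> nat mpoly" where
  "dual_char_poly n D =
     (THE p. mpoly_vars p \<subseteq> {..<n} \<and>
        (\<forall>x. (\<forall>i<n. x i \<noteq> 0) \<longrightarrow> mpoly_eval id x p = dual_char n D x))"

section \<open>Linearly independent families\<close>

definition independent_family :: "('i \<Rightarrow> 'v mpoly) \<Rightarrow> 'i set \<Rightarrow> bool" where
  "independent_family f I \<longleftrightarrow> inj_on f I \<and> mpoly.independent (f ` I)"

end

theory Submission
  imports Defs
begin

text \<open>
  Order monomials so that every flagged minor of \<open>Y\<close> with rows \<open>R\<close> and columns \<open>S\<close>, \<open>R \<le> S\<close>, has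
  a unique leading term, the product of the variables in the positions \<open>(F s, s)\<close> for \<open>s \<in> S\<close>. Here
  \<open>F\<close> assigns to each \<open>s \<in> S\<close>, in increasing order, the largest unused \<open>r \<in> R\<close> with \<open>r \<le> s\<close>.
  Such an \<open>F\<close> satisfies \<open>F s = s\<close> or \<open>F s \<notin> S\<close>. If two columns of \<open>D\<close> contain \<open>s\<close>, the hypothesis
  on \<open>D\<close> says that they jointly cover everything below \<open>s\<close>, so a variable in position \<open>(r, s)\<close>
  with \<open>r < s\<close> in the leading monomial of the product of the minors can come from only one column.
  Hence distinct \<open>C \<le> D\<close> yield distinct leading monomials.
\<close>

section \<open>Leading monomials\<close>

text \<open>The weight may take equal values on different monomials, so strict maximality is
  demanded of one monomial only. This replaces a total monomial order; ties among the lower terms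
  are harmless.\<close>

definition leading :: "('m \<Rightarrow> nat) \<Rightarrow> ('m \<Rightarrow>\<^sub>0 'a::zero) \<Rightarrow> 'm \<Rightarrow> bool" where
  "leading wt p m \<longleftrightarrow>
     m \<in> Poly_Mapping.keys p \<and> (\<forall>m'\<in>Poly_Mapping.keys p. m' \<noteq> m \<longrightarrow> wt m' < wt m)"

lemma leading_unique:
  assumes "leading wt p m" "leading wt p m'"
  shows "m = m'"
  using assms unfolding leading_def by (metis less_asym)

text \<open>By additivity only the two leading terms multiply to a term of the top weight. No other
  product can cancel it, and its coefficient is nonzero for lack of zero divisors.\<close>

lemma leading_mult:
  fixes p q :: "'m::cancel_comm_monoid_add \<Rightarrow>\<^sub>0 'a::{semiring_no_zero_divisors, ring}"
  assumes add: "\<And>a b. wt (a + b) = wt a + wt b"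
    and p: "leading wt p m" and q: "leading wt q m'"
  shows "leading wt (p * q) (m + m')"
proof -
  have less: "wt (a + b) < wt (m + m')"
    if "a \<in> Poly_Mapping.keys p" "b \<in> Poly_Mapping.keys q" "a \<noteq> m \<or> b \<noteq> m'" for a b
  proof -
    have "wt a \<le> wt m" "wt b \<le> wt m'" "a \<noteq> m \<Longrightarrow> wt a < wt m" "b \<noteq> m' \<Longrightarrow> wt b < wt m'"
      using p q that by (auto simp: leading_def intro: less_imp_le)
    then show ?thesis using that(3) by (auto simp: add)
  qed
  define c d where "c = Poly_Mapping.lookup p m" and "d = Poly_Mapping.lookup q m'"
  have cd: "c \<noteq> 0" "d \<noteq> 0"
    using p q by (auto simp: leading_def c_def d_def in_keys_iff)
  define p' q' where "p' = p - Poly_Mapping.single m c" and "q' = q - Poly_Mapping.single m' d"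
  have keys: "Poly_Mapping.keys p' \<subseteq> Poly_Mapping.keys p - {m}"
      "Poly_Mapping.keys q' \<subseteq> Poly_Mapping.keys q - {m'}"
    by (auto simp: p'_def q'_def in_keys_iff lookup_minus lookup_single c_def d_def when_def
        split: if_splits)
  \<comment> \<open>Splitting off both leading terms leaves two remainders. Neither contains
    \<open>m + m'\<close>: the first by cancelling \<open>m\<close>, the second by weight.\<close>
  have pq: "p * q = Poly_Mapping.single (m + m') (c * d) + Poly_Mapping.single m c * q' + p' * q"
    by (simp add: p'_def q'_def algebra_simps mult_single)
  have "m + m' \<notin> Poly_Mapping.keys (Poly_Mapping.single m c * q')"
  proof
    assume "m + m' \<in> Poly_Mapping.keys (Poly_Mapping.single m c * q')"
    then obtain b where "b \<in> Poly_Mapping.keys q'" "m + m' = m + b"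
      using keys_mult[of "Poly_Mapping.single m c" q'] by (auto split: if_splits)
    then show False using keys by auto
  qed
  moreover have "m + m' \<notin> Poly_Mapping.keys (p' * q)"
  proof
    assume "m + m' \<in> Poly_Mapping.keys (p' * q)"
    then obtain a b where "a \<in> Poly_Mapping.keys p'" "b \<in> Poly_Mapping.keys q" "m + m' = a + b"
      using keys_mult[of p' q] by auto
    then show False using keys less[of a b] by auto
  qed
  ultimately have "Poly_Mapping.lookup (p * q) (m + m') = c * d"
    by (simp add: pq lookup_add in_keys_iff)
  moreover have "wt x < wt (m + m')" if x: "x \<in> Poly_Mapping.keys (p * q)" "x \<noteq> m + m'" for x
  proof -
    obtain a b where "a \<in> Poly_Mapping.keys p" "b \<in> Poly_Mapping.keys q" "x = a + b"
      using x(1) keys_mult[of p q] by blast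
    then show ?thesis using less[of a b] x(2) by auto
  qed
  ultimately show ?thesis
    using cd by (auto simp: leading_def in_keys_iff)
qed

lemma leading_prod:
  fixes p :: "'i \<Rightarrow> 'm::cancel_comm_monoid_add \<Rightarrow>\<^sub>0 'a::{semiring_no_zero_divisors, comm_ring_1}"
  assumes add: "\<And>a b. wt (a + b) = wt a + wt b"
    and lead: "\<And>i. i \<in> I \<Longrightarrow> leading wt (p i) (m i)" and "finite I"
  shows "leading wt (\<Prod>i\<in>I. p i) (\<Sum>i\<in>I. m i)"
  using \<open>finite I\<close> lead
proof (induction I)
  case empty
  then show ?case by (simp add: leading_def)
next
  case (insert i I)
  then show ?case by (simp add: leading_mult[OF add])
qed

text \<open>In a vanishing combination take \<open>k\<close> with nonzero coefficient and heaviest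
  \<open>m k\<close>. Any other \<open>f j\<close> with nonzero coefficient has a different leading
  monomial, no heavier than \<open>m k\<close>, so \<open>m k\<close> does not occur in
  \<open>f j\<close> and nothing cancels it.\<close>

lemma independent_family_if_leading:
  fixes f :: "'i \<Rightarrow> 'v mpoly"
  assumes fin: "finite I" and lead: "\<And>i. i \<in> I \<Longrightarrow> leading wt (f i) (m i)" and inj: "inj_on m I"
  shows "independent_family f I"
proof -
  have inj_f: "inj_on f I"
    using lead inj leading_unique by (metis (no_types, lifting) inj_on_def)
  have zero: "u i = 0" if sum: "(\<Sum>i\<in>I. mscale (u i) (f i)) = 0" and i: "i \<in> I" for u i
  proof (rule ccontr)
    assume "u i \<noteq> 0"
    define J where "J = {j \<in> I. u j \<noteq> 0}"
    have J: "finite J" "J \<noteq> {}" "J \<subseteq> I" using fin i \<open>u i \<noteq> 0\<close> by (auto simp: J_def)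
    obtain k where k: "k \<in> J" and Max: "wt (m k) = Max ((\<lambda>j. wt (m j)) ` J)"
      using obtains_MAX[OF J(1,2), of "\<lambda>j. wt (m j)"] by metis
    have max: "wt (m j) \<le> wt (m k)" if "j \<in> J" for j
      unfolding Max using J(1) that by simp
    have "Poly_Mapping.lookup (f j) (m k) = 0" if "j \<in> J" "j \<noteq> k" for j
    proof (rule ccontr)
      assume "Poly_Mapping.lookup (f j) (m k) \<noteq> 0"
      moreover have "m k \<noteq> m j" using that inj k J(3) by (metis inj_onD subsetD)
      ultimately have "wt (m k) < wt (m j)"
        using lead[of j] that(1) J(3) by (auto simp: leading_def in_keys_iff)
      with max[OF that(1)] show False by simp
    qed
    then have "(\<Sum>j\<in>I - {k}. u j * Poly_Mapping.lookup (f j) (m k)) = 0"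
      by (intro sum.neutral) (auto simp: J_def)
    moreover have "(\<Sum>j\<in>I. u j * Poly_Mapping.lookup (f j) (m k)) = 0"
      using arg_cong[OF sum, of "\<lambda>p. Poly_Mapping.lookup p (m k)"]
      by (simp add: lookup_sum lookup_mscale)
    ultimately have "u k * Poly_Mapping.lookup (f k) (m k) = 0"
      using fin k J(3) by (simp add: sum.remove[of I k] subset_iff)
    then show False
      using k J(3) lead[of k] by (auto simp: J_def leading_def in_keys_iff)
  qed
  have "mpoly.independent (f ` I)"
  proof (rule mpoly.independent_if_scalars_zero)
    show "finite (f ` I)" using fin by simp
  next
    fix u x assume "(\<Sum>x\<in>f ` I. mscale (u x) x) = 0" "x \<in> f ` I"
    then show "u x = 0"
      using zero[of "\<lambda>i. u (f i)"] by (auto simp: sum.reindex[OF inj_f])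
  qed
  with inj_f show ?thesis by (simp add: independent_family_def)
qed

section \<open>Leading monomials of flagged minors\<close>

definition mweight :: "('v \<Rightarrow> nat) \<Rightarrow> ('v \<Rightarrow>\<^sub>0 nat) \<Rightarrow> nat" where
  "mweight w m = (\<Sum>v\<in>Poly_Mapping.keys m. Poly_Mapping.lookup m v * w v)"

lemma mweight_add: "mweight w (a + b) = mweight w a + mweight w b"
  unfolding mweight_def by (rule setsum_keys_plus_distrib) (simp_all add: algebra_simps)

lemma mweight_single [simp]: "mweight w (Poly_Mapping.single v k) = k * w v"
  by (simp add: mweight_def)

lemma mweight_sum: "mweight w (\<Sum>i\<in>I. m i) = (\<Sum>i\<in>I. mweight w (m i))"
proof (induction I rule: infinite_finite_induct)
  case (insert i I)
  then show ?case by (simp add: mweight_add)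
qed (simp_all add: mweight_def)

section \<open>Greedy permutations among the nonzero Leibniz terms of a flagged minor\<close>

definition flag_perms :: "nat \<Rightarrow> (nat \<Rightarrow> nat) \<Rightarrow> (nat \<Rightarrow> nat) \<Rightarrow> (nat \<Rightarrow> nat) set" where
  "flag_perms m r s = {q. q permutes {..<m} \<and> (\<forall>k<m. r (q k) \<le> s k)}"

lemma finite_flag_perms: "finite (flag_perms m r s)"
  by (rule finite_subset[OF _ finite_permutations[of "{..<m}"]]) (auto simp: flag_perms_def)

definition greedy :: "nat \<Rightarrow> (nat \<Rightarrow> nat) \<Rightarrow> (nat \<Rightarrow> nat) \<Rightarrow> (nat \<Rightarrow> nat) \<Rightarrow> bool" where
  "greedy m r s q \<longleftrightarrow> (\<forall>k k'. k < k' \<and> k' < m \<longrightarrow> r (q k') < r (q k) \<or> s k < r (q k'))"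

text \<open>At the first disagreement \<open>k\<close> both permutations have the same rows left.
  The row one of them takes there is used later by the other, which by greediness took a larger row
  at \<open>k\<close>. By symmetry each row exceeds the other.\<close>

lemma greedy_unique:
  assumes r: "inj_on r {..<m}"
    and p: "p \<in> flag_perms m r s" "greedy m r s p"
    and q: "q \<in> flag_perms m r s" "greedy m r s q"
  shows "p = q"
proof (rule ccontr)
  have pp: "p permutes {..<m}" and qp: "q permutes {..<m}"
    using p(1) q(1) by (auto simp: flag_perms_def)
  assume "p \<noteq> q"
  then obtain k where k: "p k \<noteq> q k" "\<And>l. l < k \<Longrightarrow> p l = q l"
    using exists_least_iff[of "\<lambda>k. p k \<noteq> q k"] by auto
  have km: "k < m"
    using k(1) pp qp by (metis lessThan_iff permutes_not_in)
  have less: "r (g k) < r (f k)"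
    if f: "f \<in> flag_perms m r s" "greedy m r s f" and g: "g \<in> flag_perms m r s"
      and ne: "f k \<noteq> g k" and eq: "\<And>l. l < k \<Longrightarrow> f l = g l" for f g
  proof -
    have fp: "f permutes {..<m}" and gp: "g permutes {..<m}"
      using f(1) g by (auto simp: flag_perms_def)
    have "g k < m" using permutes_in_image[OF gp] km by simp
    then obtain l where l: "l < m" "f l = g k"
      using permutes_image[OF fp] by (metis imageE lessThan_iff)
    have "\<not> l < k"
      using eq[of l] l(2) permutes_inj[OF gp] by (auto dest: injD)
    with ne l have "k < l" by (metis nat_neq_iff)
    moreover have "r (f l) \<le> s k" using g km by (simp add: flag_perms_def l(2))
    ultimately show ?thesis using f(2) l by (metis greedy_def not_le)
  qed
  show False
    using less[OF p q(1) k] less[OF q p(1) k(1)[symmetric] k(2)[symmetric]] by simp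
qed

text \<open>
  The weight \<open>i (n - j)\<close> of \<open>y\<^sub>i\<^sub>j\<close> rewards assigning large rows to small columns: removing
  a violation of greediness by a transposition strictly increases the total weight.
\<close>

lemma greedy_if_max:
  assumes s: "strict_mono_on {..<m} s" "\<And>k. k < m \<Longrightarrow> s k < n"
    and r: "inj_on r {..<m}"
    and q: "q \<in> flag_perms m r s"
    and max: "\<And>p. p \<in> flag_perms m r s \<Longrightarrow>
      (\<Sum>k<m. r (p k) * (n - s k)) \<le> (\<Sum>k<m. r (q k) * (n - s k))"
  shows "greedy m r s q"
proof (rule ccontr)
  have qp: "q permutes {..<m}" using q by (auto simp: flag_perms_def)
  assume "\<not> greedy m r s q"
  then obtain k k' where k: "k < k'" "k' < m" "r (q k) \<le> r (q k')" "r (q k') \<le> s k"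
    by (auto simp: greedy_def not_less)
  have "q k \<noteq> q k'" using permutes_inj[OF qp] k(1) by (auto dest: injD)
  moreover have "q k < m" "q k' < m" using permutes_in_image[OF qp] k by simp_all
  ultimately have "r (q k) \<noteq> r (q k')" using r by (auto dest: inj_onD)
  with k(3) have rlt: "r (q k) < r (q k')" by simp
  have slt: "s k < s k'" "s k' < n" using s k by (auto simp: strict_mono_on_def)
  \<comment> \<open>The swap stays admissible: \<open>r (q k') \<le> s k\<close> is part of the
    violation, and \<open>r (q k) \<le> s k < s k'\<close>.\<close>
  define p where "p = q \<circ> transpose k k'"
  have pk: "p k = q k'" "p k' = q k" and pl: "\<And>l. l \<noteq> k \<Longrightarrow> l \<noteq> k' \<Longrightarrow> p l = q l"
    by (auto simp: p_def)
  have "p permutes {..<m}"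
    unfolding p_def using qp k by (intro permutes_compose permutes_swap_id) auto
  moreover have "r (p l) \<le> s l" if "l < m" for l
    using that k q slt pk pl[of l]
    by (cases "l = k"; cases "l = k'") (auto simp: flag_perms_def intro: order_trans)
  ultimately have p_mem: "p \<in> flag_perms m r s" by (simp add: flag_perms_def)
  have split: "(\<Sum>l<m. g l) = g k + g k' + (\<Sum>l\<in>{..<m} - {k, k'}. g l)" for g :: "nat \<Rightarrow> nat"
  proof -
    have "(\<Sum>l<m. g l) = (\<Sum>l\<in>{k, k'}. g l) + (\<Sum>l\<in>{..<m} - {k, k'}. g l)"
      using k by (subst sum.subset_diff[of "{k, k'}"]) auto
    then show ?thesis using k(1) by simp
  qed
  have "(\<Sum>l\<in>{..<m} - {k, k'}. r (p l) * (n - s l)) =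
      (\<Sum>l\<in>{..<m} - {k, k'}. r (q l) * (n - s l))"
    by (rule sum.cong) (auto simp: pl)
  then have "r (q k') * (n - s k) + r (q k) * (n - s k') \<le>
      r (q k) * (n - s k) + r (q k') * (n - s k')"
    using max[OF p_mem] unfolding split by (simp add: pk)
  \<comment> \<open>With the two gaps written as \<open>Suc d\<close> and \<open>Suc e\<close>, the
    inequality would say that their product is at most 0.\<close>
  moreover obtain d where "r (q k') = r (q k) + Suc d"
    using rlt less_imp_Suc_add by auto
  moreover have "n - s k' < n - s k" using slt by linarith
  then obtain e where "n - s k = n - s k' + Suc e"
    by (metis add_Suc_right less_imp_Suc_add)
  ultimately show False by (simp add: algebra_simps)
qed

text \<open>The identity is admissible, so a maximiser exists. Every maximiser is greedy, and there
  is only one greedy permutation, so the maximum is strict.\<close>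

lemma ex_greedy_max:
  assumes s: "strict_mono_on {..<m} s" "\<And>k. k < m \<Longrightarrow> s k < n"
    and r: "inj_on r {..<m}" and le: "\<And>k. k < m \<Longrightarrow> r k \<le> s k"
  shows "\<exists>q\<in>flag_perms m r s. greedy m r s q \<and>
    (\<forall>p\<in>flag_perms m r s. p \<noteq> q \<longrightarrow>
      (\<Sum>k<m. r (p k) * (n - s k)) < (\<Sum>k<m. r (q k) * (n - s k)))"
proof -
  define W where "W = (\<lambda>p. \<Sum>k<m. r (p k) * (n - s k))"
  have "id \<in> flag_perms m r s"
    using le by (simp add: flag_perms_def permutes_id)
  then obtain q where q: "q \<in> flag_perms m r s" "W q = Max (W ` flag_perms m r s)"
    using obtains_MAX[OF finite_flag_perms[of m r s], of W] by (metis empty_iff)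
  have max: "W p \<le> W q" if "p \<in> flag_perms m r s" for p
    unfolding q(2) using finite_flag_perms that by simp
  have greedy: "greedy m r s p" if "p \<in> flag_perms m r s" "W p = W q" for p
    using greedy_if_max[OF s r that(1)] max that(2) by (simp add: W_def)
  have "W p < W q" if "p \<in> flag_perms m r s" "p \<noteq> q" for p
    using greedy[OF that(1)] greedy[OF q(1) refl] greedy_unique[OF r] q(1) max that
    by (metis le_neq_implies_less)
  with greedy[OF q(1) refl] q(1) show ?thesis by (auto simp: W_def)
qed

lemma lookup_sign_mult:
  fixes x :: "'m::monoid_add \<Rightarrow>\<^sub>0 'a::comm_ring_1"
  shows "Poly_Mapping.lookup (of_int (sign p) * x) m = of_int (sign p) * Poly_Mapping.lookup x m"
  by (cases p rule: sign_cases) simp_all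

definition greedy_matching :: "nat set \<Rightarrow> (nat \<Rightarrow> nat) \<Rightarrow> bool" where
  "greedy_matching S F \<longleftrightarrow>
     (\<forall>s\<in>S. F s \<le> s) \<and> (\<forall>s\<in>S. \<forall>t\<in>S. s < t \<longrightarrow> F t < F s \<or> s < F t)"

text \<open>If \<open>F s < s\<close>, the greedy rule for the pair \<open>F s < s\<close> in
  \<open>S\<close> gives \<open>F s < F (F s)\<close> or \<open>F s < F s\<close>, but
  \<open>F (F s) \<le> F s\<close>.\<close>

lemma greedy_matching_fixed:
  assumes "greedy_matching S F" "s \<in> S" "F s \<in> S"
  shows "F s = s"
proof (rule ccontr)
  assume "F s \<noteq> s"
  moreover have "F s \<le> s" "F (F s) \<le> F s" using assms by (auto simp: greedy_matching_def)
  ultimately show False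
    using assms unfolding greedy_matching_def by (metis le_neq_implies_less less_irrefl not_le)
qed

text \<open>In the Leibniz expansion exactly the terms of \<open>flag_perms\<close> avoid the zeros
  below the diagonal of \<open>Y\<close>, and the greedy one is strictly heaviest. \<open>F\<close>
  is that permutation read as a map from columns to rows; its image returns
  \<open>R\<close>.\<close>

lemma leading_flagged_minor:
  assumes R: "R \<subseteq> {..<n}" and S: "S \<subseteq> {..<n}" and le: "subset_le R S"
  shows "\<exists>F. F ` S = R \<and> greedy_matching S F \<and>
    leading (mweight (\<lambda>(i, j). i * (n - j))) (det (submatrix (Ymat n) R S))
      (\<Sum>s\<in>S. Poly_Mapping.single (F s, s) 1)"
proof -
  define m where "m = card S"
  define r s where "r = pick R" and "s = pick S"
  define wt where "wt = mweight (\<lambda>(i, j). i * (n - j))"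
  have card: "card R = m" and rs: "\<And>k. k < m \<Longrightarrow> r k \<le> s k"
    using le by (auto simp: subset_le_def m_def r_def s_def)
  have fin: "finite R" "finite S" using R S finite_subset by auto
  have r: "strict_mono_on {..<m} r" and s: "strict_mono_on {..<m} s"
    using card by (auto simp: strict_mono_on_def r_def s_def m_def intro: pick_mono_le)
  have rm: "\<And>k. k < m \<Longrightarrow> r k \<in> R" and sm: "\<And>k. k < m \<Longrightarrow> s k \<in> S"
    using card by (auto simp: r_def s_def m_def intro: pick_in_set_le)
  have rn: "\<And>k. k < m \<Longrightarrow> r k < n" and sn: "\<And>k. k < m \<Longrightarrow> s k < n"
    using rm sm R S by auto
  note inj = strict_mono_on_imp_inj_on[OF r] strict_mono_on_imp_inj_on[OF s]
  have rim: "r ` {..<m} = R" and sim: "s ` {..<m} = S"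
    using rm sm card inj
    by (auto intro!: card_subset_eq[OF fin(1)] card_subset_eq[OF fin(2)] simp: card_image m_def)
  obtain q where q: "q \<in> flag_perms m r s" "greedy m r s q"
    and max: "\<And>p. p \<in> flag_perms m r s \<Longrightarrow> p \<noteq> q \<Longrightarrow>
      (\<Sum>k<m. r (p k) * (n - s k)) < (\<Sum>k<m. r (q k) * (n - s k))"
    using ex_greedy_max[OF s sn inj(1) rs] by blast
  have qp: "q permutes {..<m}" using q by (simp add: flag_perms_def)
  define mu where "mu p = (\<Sum>k<m. Poly_Mapping.single (r (p k), s k) (1::nat))" for p
  have wt_mu: "wt (mu p) = (\<Sum>k<m. r (p k) * (n - s k))" for p
    by (simp add: wt_def mu_def mweight_sum)
  have dims: "{i. i < n \<and> i \<in> R} = R" "{i. i < n \<and> i \<in> S} = S" using R S by auto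
  have sub: "submatrix (Ymat n) R S = mat m m (\<lambda>(i, j). if r i \<le> s j then mvar (r i, s j) else 0)"
    unfolding submatrix_def using rn sn
    by (intro eq_matI) (simp_all add: Ymat_def dims card m_def[symmetric] r_def[symmetric] s_def[symmetric])
  have mono: "(\<Prod>k\<in>K. mvar (r (p k), s k)) =
      Poly_Mapping.single (\<Sum>k\<in>K. Poly_Mapping.single (r (p k), s k) (1::nat)) (1::complex)"
    if "finite K" for K p
    using that by (induction K) (simp_all add: mvar_def mult_single)
  have entries: "(\<Prod>k<m. submatrix (Ymat n) R S $$ (p k, k)) =
      (if p \<in> flag_perms m r s then Poly_Mapping.single (mu p) 1 else 0)"
    if p: "p permutes {..<m}" for p
  proof -
    have "(\<Prod>k<m. submatrix (Ymat n) R S $$ (p k, k)) =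
        (\<Prod>k<m. if r (p k) \<le> s k then mvar (r (p k), s k) else 0)"
      using permutes_in_image[OF p] by (intro prod.cong) (auto simp: sub)
    also have "\<dots> = (if p \<in> flag_perms m r s then Poly_Mapping.single (mu p) 1 else 0)"
    proof (cases "p \<in> flag_perms m r s")
      case True
      then show ?thesis using mono[of "{..<m}" p] by (simp add: flag_perms_def mu_def)
    next
      case False
      then obtain k where "k < m" "\<not> r (p k) \<le> s k" using p by (auto simp: flag_perms_def)
      then have "(\<Prod>k<m. if r (p k) \<le> s k then mvar (r (p k), s k) else 0) =
          (0 :: (nat \<times> nat) mpoly)"
        by (intro prod_zero bexI[of _ k]) simp_all
      then show ?thesis using False by simp
    qed
    finally show ?thesis .
  qed
  have "det (submatrix (Ymat n) R S) =
      (\<Sum>p | p permutes {..<m}. of_int (sign p) * (\<Prod>k<m. submatrix (Ymat n) R S $$ (p k, k)))"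
    by (subst det_col[of _ m]) (simp_all add: sub atLeast0LessThan)
  also have "\<dots> = (\<Sum>p | p permutes {..<m}. if p \<in> flag_perms m r s
      then of_int (sign p) * Poly_Mapping.single (mu p) 1 else 0)"
    by (rule sum.cong) (auto simp: entries)
  also have "\<dots> = (\<Sum>p\<in>flag_perms m r s. of_int (sign p) * Poly_Mapping.single (mu p) 1)"
    by (rule sum.mono_neutral_cong_right) (auto simp: flag_perms_def finite_permutations)
  finally have det: "Poly_Mapping.lookup (det (submatrix (Ymat n) R S)) x =
      (\<Sum>p\<in>flag_perms m r s. of_int (sign p) * (1 when mu p = x))" for x
    by (simp add: lookup_sum lookup_sign_mult lookup_single)
  have lead: "leading wt (det (submatrix (Ymat n) R S)) (mu q)"
    unfolding leading_def
  proof (intro conjI ballI impI)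
    \<comment> \<open>Strictness of the maximum separates \<open>mu q\<close> from all other
      monomials, so its coefficient is the single sign of \<open>q\<close>.\<close>
    have "mu p \<noteq> mu q" if "p \<in> flag_perms m r s" "p \<noteq> q" for p
      using max[OF that] by (metis wt_mu less_irrefl)
    then have "Poly_Mapping.lookup (det (submatrix (Ymat n) R S)) (mu q) = of_int (sign q)"
      unfolding det using q(1)
      by (subst sum.remove[OF finite_flag_perms, of q]) (auto intro!: sum.neutral)
    then show "mu q \<in> Poly_Mapping.keys (det (submatrix (Ymat n) R S))"
      by (simp add: in_keys_iff)
  next
    fix x
    assume x: "x \<in> Poly_Mapping.keys (det (submatrix (Ymat n) R S))" "x \<noteq> mu q"
    have "\<exists>p\<in>flag_perms m r s. mu p = x"
    proof (rule ccontr)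
      assume "\<not> ?thesis"
      then have "Poly_Mapping.lookup (det (submatrix (Ymat n) R S)) x = 0"
        unfolding det by (intro sum.neutral) auto
      with x(1) show False by (simp add: in_keys_iff)
    qed
    then obtain p where p: "p \<in> flag_perms m r s" "mu p = x" by blast
    with x(2) have "p \<noteq> q" by auto
    then show "wt x < wt (mu q)" using max p by (simp add: wt_mu flip: p(2))
  qed
  define F where "F t = r (q (the_inv_into {..<m} s t))" for t
  have Fs: "F (s k) = r (q k)" if "k < m" for k
    using that inj(2) by (simp add: F_def the_inv_into_f_f)
  have "(\<Sum>t\<in>S. Poly_Mapping.single (F t, t) 1) = mu q"
    unfolding mu_def sim[symmetric] by (subst sum.reindex[OF inj(2)]) (simp add: Fs)
  moreover have "F ` S = R"
  proof -
    have "F ` S = r ` q ` {..<m}" unfolding sim[symmetric] image_image by (simp add: Fs)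
    then show ?thesis using permutes_image[OF qp] rim by simp
  qed
  moreover have "F t \<le> t" if "t \<in> S" for t
    using that q(1) by (auto simp: sim[symmetric] Fs flag_perms_def)
  moreover have "F t' < F t \<or> t < F t'" if t: "t \<in> S" "t' \<in> S" "t < t'" for t t'
  proof -
    obtain k k' where k: "k < m" "k' < m" "t = s k" "t' = s k'"
      using t(1,2) by (auto simp: sim[symmetric])
    have "k < k'" using strict_mono_on_less[OF s, of k k'] k t(3) by simp
    then show ?thesis using q(2) k by (auto simp: greedy_def Fs)
  qed
  ultimately show ?thesis using lead unfolding wt_def greedy_matching_def
    by (intro exI[of _ F]) auto
qed

section \<open>Diagrams\<close>

text \<open>If \<open>F j s < s\<close>, its variable must occur on the other side, through some
  \<open>i\<close> with \<open>G i s = F j s\<close>. When \<open>i\<close> differs from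
  \<open>j\<close>, \<open>cover\<close> puts this row into \<open>S i\<close> or
  \<open>S j\<close>, and a greedy matching takes a value in its own domain only at a fixed point.
  So a disagreement at \<open>s\<close> forces both values to equal \<open>s\<close>.\<close>

lemma greedy_matchings_eq:
  fixes F G :: "'j \<Rightarrow> nat \<Rightarrow> nat" and S :: "'j \<Rightarrow> nat set"
  assumes J: "finite J" and S: "\<And>j. j \<in> J \<Longrightarrow> finite (S j)"
    and cover: "\<And>i j s r. \<lbrakk>i \<in> J; j \<in> J; i \<noteq> j; s \<in> S i; s \<in> S j; r < s\<rbrakk> \<Longrightarrow> r \<in> S i \<union> S j"
    and F: "\<And>j. j \<in> J \<Longrightarrow> greedy_matching (S j) (F j)"
    and G: "\<And>j. j \<in> J \<Longrightarrow> greedy_matching (S j) (G j)"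
    and eq: "(\<Sum>j\<in>J. \<Sum>s\<in>S j. Poly_Mapping.single (F j s, s) (1::nat)) =
             (\<Sum>j\<in>J. \<Sum>s\<in>S j. Poly_Mapping.single (G j s, s) 1)"
    and j: "j \<in> J" and s: "s \<in> S j"
  shows "F j s = G j s"
proof -
  have count: "Poly_Mapping.lookup (\<Sum>j\<in>J. \<Sum>s\<in>S j. Poly_Mapping.single (H j s, s) (1::nat)) (r, s)
      \<noteq> 0 \<longleftrightarrow> (\<exists>j\<in>J. s \<in> S j \<and> H j s = r)" for H r
  proof -
    have "Poly_Mapping.lookup (\<Sum>j\<in>J. \<Sum>s\<in>S j. Poly_Mapping.single (H j s, s) (1::nat)) (r, s) =
        (\<Sum>j\<in>J. \<Sum>t\<in>S j. if H j t = r \<and> t = s then 1 else 0)"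
      by (simp add: lookup_sum lookup_single when_def del: One_nat_def)
    then show ?thesis using J S by auto
  qed
  \<comment> \<open>Stated for arbitrary \<open>F\<close> and \<open>G\<close> so that it can be
    used again with the two families exchanged.\<close>
  have step: "F j s = s"
    if ne: "F j s \<noteq> G j s"
      and F: "\<forall>j\<in>J. greedy_matching (S j) (F j)" and G: "\<forall>j\<in>J. greedy_matching (S j) (G j)"
      and eq: "(\<Sum>j\<in>J. \<Sum>s\<in>S j. Poly_Mapping.single (F j s, s) (1::nat)) =
             (\<Sum>j\<in>J. \<Sum>s\<in>S j. Poly_Mapping.single (G j s, s) 1)" for F G
  proof (rule ccontr)
    assume neq: "F j s \<noteq> s"
    have "\<exists>i\<in>J. s \<in> S i \<and> F i s = F j s" using j s by blast
    then obtain i where i: "i \<in> J" "s \<in> S i" "G i s = F j s"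
      unfolding count[symmetric] eq unfolding count by blast
    with ne have "i \<noteq> j" by auto
    moreover have "F j s < s" using F j s neq by (force simp: greedy_matching_def)
    ultimately have "F j s \<in> S i \<union> S j" using cover i j s by blast
    then show False
      using greedy_matching_fixed[of "S j" "F j" s] greedy_matching_fixed[of "S i" "G i" s]
        F G i j s neq by auto
  qed
  have FG: "\<forall>j\<in>J. greedy_matching (S j) (F j)" "\<forall>j\<in>J. greedy_matching (S j) (G j)"
    using F G by auto
  show ?thesis
  proof (rule ccontr)
    assume ne: "F j s \<noteq> G j s"
    show False
      using ne step[OF ne FG eq] step[OF ne[symmetric] FG(2,1) eq[symmetric]] by simp
  qed
qed

theorem theorem2p3:
  fixes n :: nat and D :: "(nat \<times> nat) set" and a :: "nat \<Rightarrow>\<^sub>0 nat"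
  assumes "D \<subseteq> {..<n} \<times> {..<n}"
    and "\<not> (\<exists>i\<^sub>1 i\<^sub>2 j\<^sub>1 j\<^sub>2. i\<^sub>1 < i\<^sub>2 \<and> i\<^sub>2 < n \<and> j\<^sub>1 < j\<^sub>2 \<and> j\<^sub>2 < n \<and>
             (i\<^sub>1, j\<^sub>1) \<notin> D \<and> (i\<^sub>1, j\<^sub>2) \<notin> D \<and> (i\<^sub>2, j\<^sub>1) \<in> D \<and> (i\<^sub>2, j\<^sub>2) \<in> D)"
    and "a \<in> Poly_Mapping.keys (dual_char_poly n D)"
  shows "independent_family (\<lambda>C. diagram_det n C D)
           {C \<in> diagrams_below n D. diagram_monom n C = mmonom a}"
proof -
  let ?wt = "mweight (\<lambda>(i, j). i * (n - j))"
  let ?I = "{C \<in> diagrams_below n D. diagram_monom n C = mmonom a}"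
  have D: "column D j \<subseteq> {..<n}" for j using assms(1) by (auto simp: column_def)
  define good where "good C j F \<longleftrightarrow> F ` column D j = column C j \<and>
      greedy_matching (column D j) F \<and>
      leading ?wt (det (submatrix (Ymat n) (column C j) (column D j)))
        (\<Sum>s\<in>column D j. Poly_Mapping.single (F s, s) 1)" for C j F
  define F where "F C j = (SOME F. good C j F)" for C j
  have F: "good C j (F C j)" if "C \<in> diagrams_below n D" "j < n" for C j
  proof -
    have "\<exists>F. good C j F"
      unfolding good_def using that D
      by (intro leading_flagged_minor) (auto simp: diagrams_below_def column_def)
    then show ?thesis unfolding F_def by (rule someI_ex)
  qed
  define M where "M C = (\<Sum>j<n. \<Sum>s\<in>column D j. Poly_Mapping.single (F C j s, s) (1::nat))" for C
  have lead: "leading ?wt (diagram_det n C D) (M C)" if "C \<in> diagrams_below n D" for C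
    unfolding diagram_det_def M_def using F[OF that]
    by (intro leading_prod mweight_add) (auto simp: good_def)
  \<comment> \<open>The excluded configuration has \<open>r\<close> as its upper row and
    \<open>s\<close> as its lower row; the columns \<open>i\<close> and \<open>j\<close> may come in
    either order.\<close>
  have cover: "r \<in> column D i \<union> column D j"
    if "i < n" "j < n" "i \<noteq> j" "s \<in> column D i" "s \<in> column D j" "r < s" for i j r s
  proof -
    have "s < n" using D that(4) by auto
    then show ?thesis
      using assms(2) that unfolding column_def by (metis UnCI linorder_neqE_nat mem_Collect_eq)
  qed
  \<comment> \<open>Equal leading monomials force equal matchings, and the matching of column
    \<open>j\<close> has image \<open>column C j\<close>, so it determines the diagram.\<close>
  have inj: "inj_on M (diagrams_below n D)"
  proof (rule inj_onI)
    fix C C' assume C: "C \<in> diagrams_below n D" "C' \<in> diagrams_below n D" and "M C = M C'"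
    have "F C j s = F C' j s" if "j < n" "s \<in> column D j" for j s
      using F[OF C(1)] F[OF C(2)] cover finite_subset[OF D] \<open>M C = M C'\<close> that
      by (intro greedy_matchings_eq[of "{..<n}" "column D" "F C" "F C'"]) (auto simp: M_def good_def)
    then have "F C j ` column D j = F C' j ` column D j" if "j < n" for j
      using that by (intro image_cong) auto
    then have "column C j = column C' j" if "j < n" for j
      using F[OF C(1) that] F[OF C(2) that] that by (simp add: good_def)
    moreover have "column C j = {}" "column C' j = {}" if "\<not> j < n" for j
      using C that by (auto simp: diagrams_below_def column_def)
    ultimately have "column C j = column C' j" for j by (cases "j < n") auto
    then show "C = C'" by (auto simp: column_def set_eq_iff)
  qed
  show ?thesis
  proof (rule independent_family_if_leading)
    have "diagrams_below n D \<subseteq> Pow ({..<n} \<times> {..<n})" by (auto simp: diagrams_below_def)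
    then have "finite (diagrams_below n D)" by (rule finite_subset) simp
    then show "finite ?I" by simp
    show "leading ?wt (diagram_det n C D) (M C)" if "C \<in> ?I" for C
      using lead that by simp
    show "inj_on M ?I" using inj by (rule inj_on_subset) auto
  qed
qed

end
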